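(* Let $\mathcal{H}$ be a nonzero complex Hilbert space and let $A,B\in\mathbb{B}(\mathcal{H})$. Then $$\omega(A+B)\le \frac{1}{\sqrt{2}}\,\omega\big((|A|+|A^*|)+i(|B|+|B^*|)\big).$$ Further, the factor $\frac{1}{\sqrt{2}}$ is best possible: there is no real constant $c<\frac{1}{\sqrt{2}}$ such that $\omega(A+B)\le c\,\omega\big((|A|+|A^*|)+i(|B|+|B^*|)\big)$ holds for all $A,B\in\mathbb{B}(\mathcal{H})$.
   Context: $\mathbb{B}(\mathcal{H})$ is the $C^*$-algebra of bounded linear operators on $\mathcal{H}$; $A^*$ is the adjoint of $A$ and $|A|=(A^*A)^{1/2}$. The numerical radius is $\omega(A)=\sup_{\|x\|=1}|\langle Ax,x\rangle|$. *)

theory Defs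
  imports "HOL-Analysis.Analysis"
begin

text \<open>
  Complex inner product spaces, presented as a complex structure on the underlying real inner
  product space: the real scalar multiplication, inner product and norm are the ones induced by
  the complex data, so the library's metric, topology and completeness notions apply unchanged.
  The complex inner product is linear in its first argument.
\<close>

class complex_inner = real_inner +
  fixes scaleC :: "complex \<Rightarrow> 'a \<Rightarrow> 'a"  (infixr \<open>*\<^sub>C\<close> 75)
    and cinner :: "'a \<Rightarrow> 'a \<Rightarrow> complex"
  assumes scaleC_add_right: "a *\<^sub>C (x + y) = a *\<^sub>C x + a *\<^sub>C y"
    and scaleC_add_left: "(a + b) *\<^sub>C x = a *\<^sub>C x + b *\<^sub>C x"
    and scaleC_scaleC: "a *\<^sub>C (b *\<^sub>C x) = (a * b) *\<^sub>C x"
    and scaleC_one: "1 *\<^sub>C x = x"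
    and scaleR_scaleC: "scaleR r x = complex_of_real r *\<^sub>C x"
    and cinner_commute: "cinner x y = cnj (cinner y x)"
    and cinner_add_left: "cinner (x + y) z = cinner x z + cinner y z"
    and cinner_scaleC_left: "cinner (a *\<^sub>C x) y = a * cinner x y"
    and inner_eq_Re_cinner: "inner x y = Re (cinner x y)"

text \<open>Positive definiteness comes from the real inner product through \<open>inner_eq_Re_cinner\<close>; the norm is the usual one:\<close>

lemma cinner_self: "cinner x x = complex_of_real ((norm x)\<^sup>2)"
proof (rule complex_eqI)
  show "Re (cinner x x) = Re (complex_of_real ((norm x)\<^sup>2))"
    by (simp add: inner_eq_Re_cinner[symmetric] power2_norm_eq_inner)
  have "Im (cinner x x) = Im (cnj (cinner x x))"
    using cinner_commute[of x x] by simp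
  then show "Im (cinner x x) = Im (complex_of_real ((norm x)\<^sup>2))"
    by simp
qed

class chilbert_space = complex_inner + complete_space

instantiation complex :: chilbert_space
begin

definition scaleC_complex :: "complex \<Rightarrow> complex \<Rightarrow> complex"
  where "scaleC_complex a x = a * x"

definition cinner_complex :: "complex \<Rightarrow> complex \<Rightarrow> complex"
  where "cinner_complex x y = x * cnj y"

instance
  by standard
    (simp_all add: scaleC_complex_def cinner_complex_def algebra_simps scaleR_conv_of_real
      inner_complex_def)

end

definition bounded_clinear :: "('a::complex_inner \<Rightarrow> 'a) \<Rightarrow> bool"
  where "bounded_clinear A \<longleftrightarrow> bounded_linear A \<and> (\<forall>c x. A (c *\<^sub>C x) = c *\<^sub>C A x)"

definition cadjoint :: "('a::complex_inner \<Rightarrow> 'a) \<Rightarrow> 'a \<Rightarrow> 'a"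
  where "cadjoint A =
    (THE A'. bounded_clinear A' \<and> (\<forall>x y. cinner (A x) y = cinner x (A' y)))"

definition positive_op :: "('a::complex_inner \<Rightarrow> 'a) \<Rightarrow> bool"
  where "positive_op T \<longleftrightarrow> bounded_clinear T \<and> (\<forall>x. cinner (T x) x \<in> \<real>\<^sub>\<ge>\<^sub>0)"

definition sqrt_op :: "('a::complex_inner \<Rightarrow> 'a) \<Rightarrow> 'a \<Rightarrow> 'a"
  where "sqrt_op T = (THE S. positive_op S \<and> S \<circ> S = T)"

definition abs_op :: "('a::complex_inner \<Rightarrow> 'a) \<Rightarrow> 'a \<Rightarrow> 'a"
  where "abs_op A = sqrt_op (cadjoint A \<circ> A)"

text \<open>
  For a bounded operator on a nonzero space the set below is nonempty and bounded above, so this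
  real supremum is the genuine one.
\<close>

definition numerical_radius :: "('a::complex_inner \<Rightarrow> 'a) \<Rightarrow> real"
  where "numerical_radius A = (SUP x\<in>{x. norm x = 1}. cmod (cinner (A x) x))"

end

(* By the mixed Schwarz inequality |<Ax,x>|^2 <= <|A|x,x> <|A*|x,x> and AM-GM, 2 |<Ax,x>| <= p and
   2 |<Bx,x>| <= q, where p + i q is the value of (|A| + |A*|) + i (|B| + |B*|) at a unit vector x;
   finally p + q <= sqrt 2 |p + i q|. Square roots of positive operators are obtained in norm from
   the iteration Y := (1 - T + Y^2) / 2, whose limit is 1 - sqrt T and which is compatible with
   intertwining relations C S = T C. Positivity, roots and the Schwarz inequality only involve the
   real inner product; a unit phase recovers the complex modulus. *)
theory Submission
  imports Defs
begin

section \<open>Riesz representation and orthogonal projection\<close>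

text \<open>\<open>cadjoint\<close> and \<open>sqrt_op\<close> are definite descriptions, so nothing
  can be said about |A| or |A*| before existence and uniqueness are proved; most of the work lies
  there. Neither functional calculus nor polar decomposition is used. The relation C S = T C, for an
  arbitrary bounded C, takes their place and is used three times: C a second root of T gives
  uniqueness; C multiplication by a complex scalar, seen as a real-linear operator, gives complex
  linearity of the root; C = A with S = A* A and T = A A* gives A |A| = |A*| A, the core of mixed
  Schwarz. Since the range of |A| need not be closed, that inequality passes by continuity to the
  closure of the range and by projection to the whole space; hence a Riesz theorem on closed
  subspaces.\<close>

lemma quadratic_nonneg_imp_discriminant:
  fixes a b c :: real
  assumes "\<And>t. 0 \<le> a + 2 * b * t + c * t\<^sup>2" and "0 \<le> a" "0 \<le> c"
  shows "b\<^sup>2 \<le> a * c"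
proof (cases "c = 0")
  case True
  have "b = 0"
  proof (rule ccontr)
    assume "b \<noteq> 0"
    \<comment> \<open>At this t the affine function takes the value -1.\<close>
    then show False using assms(1)[of "- (a + 1) / (2 * b)"] True by simp
  qed
  then show ?thesis using True by simp
next
  case False
  then have "0 < c" using assms(3) by simp
  have "0 \<le> a + 2 * b * (- b / c) + c * (- b / c)\<^sup>2" by (rule assms(1))
  also have "\<dots> = (a * c - b\<^sup>2) / c" using \<open>0 < c\<close> by (simp add: field_simps power2_eq_square)
  finally show ?thesis using \<open>0 < c\<close> by (simp add: zero_le_divide_iff)
qed

text \<open>The representing vector minimises \<open>\<parallel>x\<parallel>\<^sup>2 - 2 f x\<close> over the subspace; minimising sequences
  are Cauchy by the parallelogram law.\<close>

lemma riesz_representation_on_closed_subspace: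
  fixes f :: "'a::{real_inner, complete_space} \<Rightarrow> real"
  assumes f: "bounded_linear f" and M: "subspace M" "closed M"
  obtains u where "u \<in> M" "\<And>y. y \<in> M \<Longrightarrow> u \<bullet> y = f y"
proof -
  interpret f: bounded_linear f by (rule f)
  obtain K where K: "\<And>x. norm (f x) \<le> norm x * K" using f.bounded by blast
  define J where "J x = (norm x)\<^sup>2 - 2 * f x" for x
  have J_lower: "- (K\<^sup>2) \<le> J x" for x
  proof -
    have "0 \<le> (norm x - K)\<^sup>2" by simp
    moreover have "f x \<le> norm x * K" using K[of x] by simp
    ultimately show ?thesis by (simp add: J_def power2_diff)
  qed
  define m where "m = (INF x\<in>M. J x)"
  have bdd: "bdd_below (J ` M)" using J_lower by (auto intro!: bdd_belowI)
  have M0: "M \<noteq> {}" using M(1) by (auto simp: subspace_def)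
  have m_le: "m \<le> J x" if "x \<in> M" for x
    unfolding m_def using bdd that by (rule cINF_lower)
  have "\<exists>x. x \<in> M \<and> J x < m + 1 / Suc n" for n
  proof -
    have "(INF x\<in>M. J x) < m + 1 / Suc n" by (simp add: m_def)
    then show ?thesis using cINF_less_iff[OF M0 bdd] by blast
  qed
  then obtain x where xM: "\<And>n. x n \<in> M" and xJ: "\<And>n. J (x n) < m + 1 / Suc n" by metis
  have para: "(norm (a - b))\<^sup>2 \<le> 2 * (J a - m) + 2 * (J b - m)" if "a \<in> M" "b \<in> M" for a b
  proof -
    have "(1/2) *\<^sub>R (a + b) \<in> M" using that M(1) by (simp add: subspace_add subspace_scale)
    then have "m \<le> J ((1/2) *\<^sub>R (a + b))" by (rule m_le)
    also have "J ((1/2) *\<^sub>R (a + b)) = (J a + J b) / 2 - (norm (a - b))\<^sup>2 / 4"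
      by (simp add: J_def power2_norm_eq_inner f.add f.scaleR inner_add inner_diff
          inner_commute field_simps)
    finally show ?thesis by argo
  qed
  have "Cauchy x"
  proof (rule metric_CauchyI)
    fix e :: real assume "0 < e"
    then obtain N where N: "inverse (real (Suc N)) < e\<^sup>2 / 4"
      using reals_Archimedean[of "e\<^sup>2 / 4"] by auto
    have "dist (x i) (x j) < e" if "N \<le> i" "N \<le> j" for i j
    proof -
      have "1 / Suc i \<le> inverse (Suc N)" "1 / Suc j \<le> inverse (Suc N)"
        using that by (auto simp: field_simps)
      then have "J (x i) - m < e\<^sup>2 / 4" "J (x j) - m < e\<^sup>2 / 4"
        using xJ[of i] xJ[of j] N by argo+
      then have "(norm (x i - x j))\<^sup>2 < e\<^sup>2"
        using para[OF xM xM, of i j] by argo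
      then show ?thesis using \<open>0 < e\<close> by (simp add: dist_norm power2_less_imp_less)
    qed
    then show "\<exists>N. \<forall>i\<ge>N. \<forall>j\<ge>N. dist (x i) (x j) < e" by blast
  qed
  then obtain u where u: "x \<longlonglongrightarrow> u" using Cauchy_convergent convergent_def by blast
  have uM: "u \<in> M" using M(2) xM u closed_sequentially by blast
  have "(\<lambda>n. J (x n)) \<longlonglongrightarrow> J u" unfolding J_def by (intro tendsto_intros f.tendsto u)
  moreover have "(\<lambda>n. m + 1 / real (Suc n)) \<longlonglongrightarrow> m"
    using tendsto_add[OF tendsto_const LIMSEQ_inverse_real_of_nat, of m]
    by (simp add: inverse_eq_divide)
  ultimately have Ju: "J u \<le> m" using xJ by (meson LIMSEQ_le less_imp_le)
  have "u \<bullet> y = f y" if "y \<in> M" for y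
  proof -
    \<comment> \<open>First variation at the minimiser: with constant term 0, the discriminant bound
      kills the linear coefficient.\<close>
    have "0 \<le> 0 + 2 * (u \<bullet> y - f y) * t + (norm y)\<^sup>2 * t\<^sup>2" for t
    proof -
      have "u + t *\<^sub>R y \<in> M" using uM that M(1) by (simp add: subspace_add subspace_scale)
      then have "J u \<le> J (u + t *\<^sub>R y)" using m_le Ju by fastforce
      also have "J (u + t *\<^sub>R y) = J u + 2 * (u \<bullet> y - f y) * t + (norm y)\<^sup>2 * t\<^sup>2"
        unfolding J_def power2_norm_eq_inner
        by (simp add: f.add f.scaleR inner_add inner_commute power2_eq_square algebra_simps)
      finally show ?thesis by simp
    qed
    then have "(u \<bullet> y - f y)\<^sup>2 \<le> 0 * (norm y)\<^sup>2"
      by (rule quadratic_nonneg_imp_discriminant) auto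
    then show ?thesis by simp
  qed
  with uM show ?thesis by (rule that)
qed

text \<open>Riesz on the whole space represents x -> A x . y by \<open>A' y\<close>. Linearity comes
  from uniqueness of the representing vector, the bound from |A' y|^2 = A (A' y) . y.\<close>

lemma hilbert_adjoint_exists:
  fixes A :: "'a::{real_inner, complete_space} \<Rightarrow> 'b::real_inner"
  assumes A: "bounded_linear A"
  obtains A' where "bounded_linear A'" "\<And>x y. A x \<bullet> y = x \<bullet> A' y"
proof -
  interpret A: bounded_linear A by (rule A)
  obtain K where K: "0 \<le> K" "\<And>x. norm (A x) \<le> norm x * K" using A.nonneg_bounded by blast
  have "\<exists>u. \<forall>x. u \<bullet> x = A x \<bullet> y" for y
  proof -
    have "bounded_linear (\<lambda>x. A x \<bullet> y)"
      by (rule bounded_linear_compose[OF bounded_linear_inner_left A])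
    then obtain u where "\<And>x. x \<in> UNIV \<Longrightarrow> u \<bullet> x = A x \<bullet> y"
      using riesz_representation_on_closed_subspace subspace_UNIV closed_UNIV by metis
    then show ?thesis by blast
  qed
  then obtain A' where A': "\<And>x y. A' y \<bullet> x = A x \<bullet> y" by metis
  have "bounded_linear A'"
  proof (rule bounded_linear_intro[where K = K])
    show "A' (x + y) = A' x + A' y" for x y
      by (subst vector_eq_rdot[symmetric]) (simp add: inner_add A')
    show "A' (r *\<^sub>R x) = r *\<^sub>R A' x" for r x
      by (subst vector_eq_rdot[symmetric]) (simp add: A')
    fix y
    have "norm (A' y) * norm (A' y) = A (A' y) \<bullet> y"
      by (simp add: A'[symmetric] norm_eq_sqrt_inner)
    also have "\<dots> \<le> norm (A (A' y)) * norm y" by (rule norm_cauchy_schwarz)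
    also have "\<dots> \<le> norm (A' y) * K * norm y" using K(2) by (simp add: mult_right_mono)
    finally show "norm (A' y) \<le> norm y * K"
      using K(1) by (cases "norm (A' y) = 0") (auto simp: mult.assoc mult.commute)
  qed
  moreover have "A x \<bullet> y = x \<bullet> A' y" for x y by (metis A' inner_commute)
  ultimately show ?thesis by (rule that)
qed

lemma subspace_closure_of_subspace:
  fixes M :: "'a::real_normed_vector set"
  assumes M: "subspace M"
  shows "subspace (closure M)"
proof (rule subspaceI)
  show "0 \<in> closure M" using subspace_0[OF M] closure_subset by blast
next
  fix x y assume "x \<in> closure M" "y \<in> closure M"
  then obtain u v where "\<And>n. u n \<in> M" "u \<longlonglongrightarrow> x" "\<And>n. v n \<in> M" "v \<longlonglongrightarrow> y"
    unfolding closure_sequential by blast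
  then have "(\<forall>n. u n + v n \<in> M) \<and> (\<lambda>n. u n + v n) \<longlonglongrightarrow> x + y"
    by (simp add: subspace_add[OF M] tendsto_add)
  then show "x + y \<in> closure M"
    unfolding closure_sequential by (intro exI[where x = "\<lambda>n. u n + v n"])
next
  fix c x assume "x \<in> closure M"
  then obtain u where "\<And>n. u n \<in> M" "u \<longlonglongrightarrow> x" unfolding closure_sequential by blast
  then have "(\<forall>n. c *\<^sub>R u n \<in> M) \<and> (\<lambda>n. c *\<^sub>R u n) \<longlonglongrightarrow> c *\<^sub>R x"
    by (simp add: subspace_scale[OF M] tendsto_scaleR)
  then show "c *\<^sub>R x \<in> closure M"
    unfolding closure_sequential by (intro exI[where x = "\<lambda>n. c *\<^sub>R u n"])
qed

section \<open>Positive operators and their square roots\<close>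

text \<open>Symmetry is included because over the reals a nonnegative form does not imply it:
  consider a quarter turn of the plane.\<close>

definition pos_blinfun :: "('a::real_inner \<Rightarrow>\<^sub>L 'a) \<Rightarrow> bool"
  where "pos_blinfun T \<longleftrightarrow> (\<forall>x y. T x \<bullet> y = x \<bullet> T y) \<and> (\<forall>x. 0 \<le> T x \<bullet> x)"

lemma pos_blinfun_symmetric: "pos_blinfun T \<Longrightarrow> T x \<bullet> y = x \<bullet> T y"
  by (simp add: pos_blinfun_def)

lemma pos_blinfun_nonneg: "pos_blinfun T \<Longrightarrow> 0 \<le> T x \<bullet> x"
  unfolding pos_blinfun_def by blast

lemma pos_blinfun_cauchy_schwarz:
  assumes "pos_blinfun T"
  shows "(T x \<bullet> y)\<^sup>2 \<le> (T x \<bullet> x) * (T y \<bullet> y)"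
proof (rule quadratic_nonneg_imp_discriminant)
  fix t :: real
  have "0 \<le> T (x + t *\<^sub>R y) \<bullet> (x + t *\<^sub>R y)" by (rule pos_blinfun_nonneg[OF assms])
  also have "\<dots> = T x \<bullet> x + 2 * (T x \<bullet> y) * t + T y \<bullet> y * t\<^sup>2"
    using pos_blinfun_symmetric[OF assms, of y x]
    by (simp add: blinfun.add_right blinfun.scaleR_right inner_add inner_commute
        power2_eq_square algebra_simps)
  finally show "0 \<le> T x \<bullet> x + 2 * (T x \<bullet> y) * t + T y \<bullet> y * t\<^sup>2" .
qed (simp_all add: pos_blinfun_nonneg assms)

lemma pos_blinfun_eq_0:
  assumes "pos_blinfun T" "T x \<bullet> x = 0"
  shows "T x = 0"
  using pos_blinfun_cauchy_schwarz[OF assms(1), of x "T x"] assms(2) by simp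

text \<open>Turns an order bound into a norm bound: Cauchy-Schwarz at x and T x, with both factors
  bounded by the hypothesis, leaves one factor T x . T x to cancel.\<close>

lemma norm_pos_blinfun_le_1:
  assumes T: "pos_blinfun T" and le: "\<And>x. T x \<bullet> x \<le> x \<bullet> x"
  shows "norm T \<le> 1"
proof (rule norm_blinfun_bound)
  fix x
  have "(T x \<bullet> T x)\<^sup>2 \<le> (T x \<bullet> x) * (T (T x) \<bullet> T x)" by (rule pos_blinfun_cauchy_schwarz[OF T])
  also have "\<dots> \<le> (x \<bullet> x) * (T x \<bullet> T x)"
    by (intro mult_mono le) (simp_all add: pos_blinfun_nonneg[OF T])
  finally have "T x \<bullet> T x \<le> x \<bullet> x"
    by (cases "T x \<bullet> T x = 0") (auto simp: power2_eq_square)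
  then show "norm (T x) \<le> 1 * norm x" by (simp add: norm_le)
qed simp

interpretation blinfun_comp: bounded_bilinear "(o\<^sub>L)"
  by (rule bounded_bilinear_blinfun_compose)

lemma blinfun_compose_assoc: "(A o\<^sub>L B) o\<^sub>L C = A o\<^sub>L (B o\<^sub>L C)"
  by (rule blinfun_eqI) simp

lemma blinfun_compose_id [simp]: "A o\<^sub>L id_blinfun = A" "id_blinfun o\<^sub>L A = A"
  by (rule blinfun_eqI, simp)+

section \<open>Norm convergence of the square root iteration\<close>

primrec sqrt_iter :: "('a::real_normed_vector \<Rightarrow>\<^sub>L 'a) \<Rightarrow> nat \<Rightarrow> 'a \<Rightarrow>\<^sub>L 'a" where
  "sqrt_iter A 0 = 0"
| "sqrt_iter A (Suc n) = (1/2) *\<^sub>R (A + (sqrt_iter A n o\<^sub>L sqrt_iter A n))"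

text \<open>The iteration with \<open>A\<close> replaced by 1, the largest norm allowed. The map Y
  -> (A + Y^2)/2 is in general only 1-Lipschitz on the unit ball, so no contraction argument
  applies; domination by this bounded increasing sequence replaces it.\<close>

primrec sqrt_majorant :: "nat \<Rightarrow> real" where
  "sqrt_majorant 0 = 0"
| "sqrt_majorant (Suc n) = (1 + (sqrt_majorant n)\<^sup>2) / 2"

lemma sqrt_majorant_bounds: "0 \<le> sqrt_majorant n \<and> sqrt_majorant n \<le> 1"
proof (induction n)
  case (Suc n)
  then have "(sqrt_majorant n)\<^sup>2 \<le> 1" by (simp add: power_le_one)
  then show ?case by simp
qed simp

lemma sqrt_majorant_mono: "sqrt_majorant n \<le> sqrt_majorant (Suc n)"
proof -
  have "0 \<le> (sqrt_majorant n - 1)\<^sup>2" by simp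
  then show ?thesis by (simp add: power2_diff)
qed

lemma norm_sqrt_iter:
  assumes "norm A \<le> 1"
  shows "norm (sqrt_iter A n) \<le> sqrt_majorant n"
proof (induction n)
  case (Suc n)
  have "norm (A + (sqrt_iter A n o\<^sub>L sqrt_iter A n))
      \<le> norm A + norm (sqrt_iter A n) * norm (sqrt_iter A n)"
    using norm_triangle_ineq[of A "sqrt_iter A n o\<^sub>L sqrt_iter A n"]
      norm_blinfun_compose[of "sqrt_iter A n" "sqrt_iter A n"] by linarith
  also have "\<dots> \<le> 1 + sqrt_majorant n * sqrt_majorant n"
    using Suc by (intro add_mono mult_mono assms) (auto simp: sqrt_majorant_bounds)
  finally show ?case by (simp add: power2_eq_square)
qed simp

text \<open>Y'^2 - Y^2 = Y' D + D Y with D = Y' - Y holds without commutativity, and its norm bound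
  matches y'^2 - y^2 = (y' + y) d for the majorant.\<close>

lemma norm_sqrt_iter_step:
  assumes "norm A \<le> 1"
  shows "norm (sqrt_iter A (Suc n) - sqrt_iter A n) \<le> sqrt_majorant (Suc n) - sqrt_majorant n"
proof (induction n)
  case 0
  then show ?case using assms by simp
next
  case (Suc n)
  let ?Y = "sqrt_iter A" and ?y = sqrt_majorant
  let ?D = "?Y (Suc n) - ?Y n" and ?d = "?y (Suc n) - ?y n"
  have "?Y (Suc (Suc n)) - ?Y (Suc n)
      = (1/2) *\<^sub>R ((?Y (Suc n) o\<^sub>L ?Y (Suc n)) - (?Y n o\<^sub>L ?Y n))"
    unfolding sqrt_iter.simps(2)[of A "Suc n"]
    by (subst (3) sqrt_iter.simps) (simp only: scaleR_diff_right[symmetric] add_diff_cancel_left)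
  also have "(?Y (Suc n) o\<^sub>L ?Y (Suc n)) - (?Y n o\<^sub>L ?Y n) = (?Y (Suc n) o\<^sub>L ?D) + (?D o\<^sub>L ?Y n)"
    by (simp del: sqrt_iter.simps add: blinfun_comp.diff_left blinfun_comp.diff_right)
  finally have "norm (?Y (Suc (Suc n)) - ?Y (Suc n))
      = norm ((?Y (Suc n) o\<^sub>L ?D) + (?D o\<^sub>L ?Y n)) / 2"
    by (simp del: sqrt_iter.simps)
  also have "\<dots> \<le> (norm (?Y (Suc n)) * norm ?D + norm ?D * norm (?Y n)) / 2"
    by (intro divide_right_mono order_trans[OF norm_triangle_ineq] add_mono norm_blinfun_compose)
      simp
  also have "\<dots> \<le> (?y (Suc n) * ?d + ?d * ?y n) / 2"
    using sqrt_majorant_bounds sqrt_majorant_mono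
    by (intro divide_right_mono add_mono mult_mono norm_sqrt_iter assms Suc norm_ge_zero) auto
  also have "\<dots> = ((?y (Suc n))\<^sup>2 - (?y n)\<^sup>2) / 2"
    by (simp del: sqrt_majorant.simps add: power2_eq_square algebra_simps)
  also have "\<dots> = ?y (Suc (Suc n)) - ?y (Suc n)"
    by (simp add: field_simps)
  finally show ?case .
qed

lemma convergent_sqrt_iter:
  fixes A :: "'a::banach \<Rightarrow>\<^sub>L 'a"
  assumes "norm A \<le> 1"
  shows "convergent (sqrt_iter A)"
proof -
  let ?y = sqrt_majorant
  have "convergent ?y"
    by (rule Bseq_mono_convergent[OF BseqI'[where K = 1]])
      (auto simp: sqrt_majorant_bounds intro!: lift_Suc_mono_le sqrt_majorant_mono
        simp del: sqrt_majorant.simps)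
  then have "summable (\<lambda>n. ?y (Suc n) - ?y n)"
    using telescope_summable convergent_def by blast
  then have "summable (\<lambda>n. sqrt_iter A (Suc n) - sqrt_iter A n)"
    by (rule summable_comparison_test') (use norm_sqrt_iter_step[OF assms] in auto)
  then have "convergent (\<lambda>n. \<Sum>k<n. sqrt_iter A (Suc k) - sqrt_iter A k)"
    by (simp only: summable_iff_convergent)
  then show ?thesis by (subst (asm) sum_lessThan_telescope) simp
qed

definition sqrt_complement :: "('a::banach \<Rightarrow>\<^sub>L 'a) \<Rightarrow> ('a \<Rightarrow>\<^sub>L 'a)"
  where "sqrt_complement A = lim (sqrt_iter A)"

text \<open>\<open>1 - sqrt_complement A\<close> is the square root of \<open>1 - A\<close>. The bound \<open>k\<close> on the operator is a
  parameter so that roots of two operators can be compared term by term.\<close>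

definition bounded_root :: "real \<Rightarrow> ('a::banach \<Rightarrow>\<^sub>L 'a) \<Rightarrow> ('a \<Rightarrow>\<^sub>L 'a)"
  where "bounded_root k T =
    sqrt k *\<^sub>R (id_blinfun - sqrt_complement (id_blinfun - (1 / k) *\<^sub>R T))"

lemma sqrt_complement_tendsto:
  "norm A \<le> 1 \<Longrightarrow> sqrt_iter A \<longlonglongrightarrow> sqrt_complement A"
  unfolding sqrt_complement_def using convergent_sqrt_iter by (simp add: convergent_LIMSEQ_iff)

lemma norm_sqrt_complement:
  assumes "norm A \<le> 1"
  shows "norm (sqrt_complement A) \<le> 1"
proof (rule LIMSEQ_le_const2[OF tendsto_norm[OF sqrt_complement_tendsto[OF assms]]])
  have "norm (sqrt_iter A n) \<le> 1" for n
    using norm_sqrt_iter[OF assms, of n] sqrt_majorant_bounds[of n] by linarith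
  then show "\<exists>N. \<forall>n\<ge>N. norm (sqrt_iter A n) \<le> 1" by blast
qed

lemma sqrt_complement_eq:
  assumes "norm A \<le> 1"
  shows "2 *\<^sub>R sqrt_complement A = A + (sqrt_complement A o\<^sub>L sqrt_complement A)"
proof -
  let ?Y = "sqrt_complement A"
  note lim = sqrt_complement_tendsto[OF assms]
  have "(\<lambda>n. sqrt_iter A (Suc n)) \<longlonglongrightarrow> (1/2) *\<^sub>R (A + (?Y o\<^sub>L ?Y))"
    unfolding sqrt_iter.simps by (intro tendsto_intros blinfun_comp.tendsto lim)
  with LIMSEQ_Suc[OF lim] have "?Y = (1/2) *\<^sub>R (A + (?Y o\<^sub>L ?Y))" by (rule LIMSEQ_unique)
  then have "2 *\<^sub>R ?Y = 2 *\<^sub>R ((1/2) *\<^sub>R (A + (?Y o\<^sub>L ?Y)))" by (rule arg_cong)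
  then show ?thesis by simp
qed

text \<open>The n-th iterates are the same polynomial in \<open>A\<close> and in \<open>B\<close>,
  so the relation holds at every stage; composition is norm continuous.\<close>

lemma sqrt_complement_intertwine:
  assumes "norm A \<le> 1" "norm B \<le> 1" and CA: "C o\<^sub>L A = B o\<^sub>L C"
  shows "C o\<^sub>L sqrt_complement A = sqrt_complement B o\<^sub>L C"
proof -
  have step: "C o\<^sub>L sqrt_iter A n = sqrt_iter B n o\<^sub>L C" for n
  proof (induction n)
    case 0
    then show ?case by (simp add: blinfun_comp.zero_left blinfun_comp.zero_right)
  next
    case (Suc n)
    have "C o\<^sub>L (sqrt_iter A n o\<^sub>L sqrt_iter A n) = (sqrt_iter B n o\<^sub>L sqrt_iter B n) o\<^sub>L C"
      by (metis Suc blinfun_compose_assoc)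
    then show ?case
      by (simp add: CA blinfun_comp.add_left blinfun_comp.add_right
          blinfun_comp.scaleR_left blinfun_comp.scaleR_right)
  qed
  have "(\<lambda>n. C o\<^sub>L sqrt_iter A n) \<longlonglongrightarrow> (C o\<^sub>L sqrt_complement A)"
    by (intro blinfun_comp.tendsto tendsto_const sqrt_complement_tendsto assms)
  moreover have "(\<lambda>n. C o\<^sub>L sqrt_iter A n) \<longlonglongrightarrow> (sqrt_complement B o\<^sub>L C)"
    unfolding step by (intro blinfun_comp.tendsto tendsto_const sqrt_complement_tendsto assms)
  ultimately show ?thesis by (rule LIMSEQ_unique)
qed

lemma sqrt_complement_symmetric:
  fixes A :: "'a::{real_inner, banach} \<Rightarrow>\<^sub>L 'a"
  assumes "norm A \<le> 1" and sym: "\<And>x y. A x \<bullet> y = x \<bullet> A y"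
  shows "sqrt_complement A x \<bullet> y = x \<bullet> sqrt_complement A y"
proof -
  have "sqrt_iter A n x \<bullet> y = x \<bullet> sqrt_iter A n y" for n x y
  proof (induction n arbitrary: x y)
    case (Suc n)
    have "sqrt_iter A n (sqrt_iter A n x) \<bullet> y = x \<bullet> sqrt_iter A n (sqrt_iter A n y)"
      by (simp only: Suc)
    then show ?case by (simp add: blinfun.add_left blinfun.scaleR_left inner_add sym)
  qed simp
  moreover have "(\<lambda>n. sqrt_iter A n x \<bullet> y) \<longlonglongrightarrow> sqrt_complement A x \<bullet> y"
    by (intro tendsto_intros blinfun.tendsto sqrt_complement_tendsto assms)
  moreover have "(\<lambda>n. x \<bullet> sqrt_iter A n y) \<longlonglongrightarrow> x \<bullet> sqrt_complement A y"
    by (intro tendsto_intros blinfun.tendsto sqrt_complement_tendsto assms)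
  ultimately show ?thesis by (simp add: LIMSEQ_unique)
qed

text \<open>The order interval 0 <= T <= k is carried to 0 <= 1 - T/k <= 1. Positivity is essential:
  T = -k would give norm 2 on a nonzero space.\<close>

lemma norm_id_minus_scaled_le_1:
  fixes T :: "'a::real_inner \<Rightarrow>\<^sub>L 'a"
  assumes T: "pos_blinfun T" and k: "0 < k" "norm T \<le> k"
  shows "norm (id_blinfun - (1 / k) *\<^sub>R T) \<le> 1"
proof (rule norm_pos_blinfun_le_1)
  have le: "T x \<bullet> x \<le> k * (x \<bullet> x)" for x
  proof -
    have "T x \<bullet> x \<le> norm (T x) * norm x" by (rule norm_cauchy_schwarz)
    also have "\<dots> \<le> (k * norm x) * norm x"
      by (meson k(2) mult_right_mono norm_blinfun norm_ge_zero order_trans)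
    finally show ?thesis by (simp add: power2_norm_eq_inner[symmetric] power2_eq_square)
  qed
  show "pos_blinfun (id_blinfun - (1 / k) *\<^sub>R T)"
    using le k(1)
    by (simp add: pos_blinfun_def blinfun.diff_left blinfun.scaleR_left inner_diff
        pos_blinfun_symmetric[OF T] field_simps)
  show "(id_blinfun - (1 / k) *\<^sub>R T) x \<bullet> x \<le> x \<bullet> x" for x
    using pos_blinfun_nonneg[OF T] k(1)
    by (simp add: blinfun.diff_left blinfun.scaleR_left inner_diff)
qed

lemma bounded_root_square:
  fixes T :: "'a::{real_inner, banach} \<Rightarrow>\<^sub>L 'a"
  assumes T: "pos_blinfun T" and k: "0 < k" "norm T \<le> k"
  shows "bounded_root k T o\<^sub>L bounded_root k T = T"
proof -
  let ?A = "id_blinfun - (1 / k) *\<^sub>R T"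
  let ?Y = "sqrt_complement ?A"
  have "bounded_root k T o\<^sub>L bounded_root k T
      = k *\<^sub>R ((id_blinfun - ?Y) o\<^sub>L (id_blinfun - ?Y))"
    using k(1) by (simp add: bounded_root_def blinfun_comp.scaleR_left
        blinfun_comp.scaleR_right)
  also have "(id_blinfun - ?Y) o\<^sub>L (id_blinfun - ?Y) = id_blinfun - 2 *\<^sub>R ?Y + (?Y o\<^sub>L ?Y)"
    by (rule blinfun_eqI)
      (simp add: blinfun.diff_left blinfun.diff_right blinfun.add_left blinfun.scaleR_left scaleR_2)
  also have "\<dots> = (1 / k) *\<^sub>R T"
    using sqrt_complement_eq[OF norm_id_minus_scaled_le_1[OF assms]] by simp
  finally show ?thesis using k(1) by simp
qed

text \<open>The limit Y has norm at most 1, so Y x . x <= x . x, which makes 1 - Y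
  nonnegative.\<close>

lemma pos_bounded_root:
  fixes T :: "'a::{real_inner, banach} \<Rightarrow>\<^sub>L 'a"
  assumes T: "pos_blinfun T" and k: "0 < k" "norm T \<le> k"
  shows "pos_blinfun (bounded_root k T)"
proof -
  let ?A = "id_blinfun - (1 / k) *\<^sub>R T"
  let ?Y = "sqrt_complement ?A"
  note A1 = norm_id_minus_scaled_le_1[OF assms]
  have "?A x \<bullet> y = x \<bullet> ?A y" for x y
    by (simp add: blinfun.diff_left blinfun.scaleR_left inner_diff pos_blinfun_symmetric[OF T])
  then have sym: "?Y x \<bullet> y = x \<bullet> ?Y y" for x y using A1 by (intro sqrt_complement_symmetric)
  have "?Y x \<bullet> x \<le> x \<bullet> x" for x
  proof -
    have "?Y x \<bullet> x \<le> norm (?Y x) * norm x" by (rule norm_cauchy_schwarz)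
    also have "\<dots> \<le> (1 * norm x) * norm x"
      by (meson A1 norm_sqrt_complement mult_right_mono norm_blinfun norm_ge_zero order_trans)
    finally show ?thesis by (simp add: power2_norm_eq_inner[symmetric] power2_eq_square)
  qed
  then show ?thesis
    using k(1) by (simp add: pos_blinfun_def bounded_root_def blinfun.diff_left
        blinfun.scaleR_left inner_diff sym)
qed

lemma bounded_root_intertwine:
  fixes T :: "'a::{real_inner, banach} \<Rightarrow>\<^sub>L 'a"
  assumes "pos_blinfun S" "pos_blinfun T" "0 < k" "norm S \<le> k" "norm T \<le> k"
    and C: "C o\<^sub>L S = T o\<^sub>L C"
  shows "C o\<^sub>L bounded_root k S = bounded_root k T o\<^sub>L C"
proof -
  have "C o\<^sub>L (id_blinfun - (1 / k) *\<^sub>R S) = (id_blinfun - (1 / k) *\<^sub>R T) o\<^sub>L C"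
    by (simp add: blinfun_comp.diff_left blinfun_comp.diff_right C
        blinfun_comp.scaleR_left blinfun_comp.scaleR_right)
  then have "C o\<^sub>L sqrt_complement (id_blinfun - (1 / k) *\<^sub>R S)
      = sqrt_complement (id_blinfun - (1 / k) *\<^sub>R T) o\<^sub>L C"
    by (intro sqrt_complement_intertwine norm_id_minus_scaled_le_1 assms)
  then show ?thesis
    by (simp add: bounded_root_def blinfun_comp.diff_left blinfun_comp.diff_right
        blinfun_comp.scaleR_left blinfun_comp.scaleR_right)
qed

text \<open>\<open>S\<close> commutes with its square \<open>T\<close>, hence with the root R. Then
  (S + R)(S - R) = 0, and nonnegativity of both forms splits this into S y = R y = 0 for y = (S - R)
  x.\<close>

lemma bounded_root_unique:
  fixes T :: "'a::{real_inner, banach} \<Rightarrow>\<^sub>L 'a"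
  assumes T: "pos_blinfun T" and k: "0 < k" "norm T \<le> k"
    and S: "pos_blinfun S" "S o\<^sub>L S = T"
  shows "S = bounded_root k T"
proof (rule blinfun_eqI)
  fix x
  let ?R = "bounded_root k T"
  note R = pos_bounded_root[OF T k] bounded_root_square[OF T k]
  have "S o\<^sub>L T = T o\<^sub>L S" by (simp add: S(2)[symmetric] blinfun_compose_assoc)
  then have "S o\<^sub>L ?R = ?R o\<^sub>L S" by (intro bounded_root_intertwine T k)
  then have comm: "S (?R z) = ?R (S z)" for z
    by (metis blinfun_apply_blinfun_compose)
  have sq: "S (S z) = ?R (?R z)" for z
    using S(2) R(2) by (metis blinfun_apply_blinfun_compose)
  define y where "y = S x - ?R x"
  have "S y + ?R y = 0" by (simp add: y_def blinfun.diff_right comm sq)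
  then have "S y \<bullet> y + ?R y \<bullet> y = 0" by (simp flip: inner_add_left)
  moreover have "0 \<le> S y \<bullet> y" "0 \<le> ?R y \<bullet> y" using S(1) R(1) pos_blinfun_nonneg by blast+
  ultimately have "S y = 0" "?R y = 0" using S(1) R(1) pos_blinfun_eq_0 by force+
  \<comment> \<open>By symmetry |y|^2 = (S - R) y . x, and both terms vanish.\<close>
  have "y \<bullet> y = S y \<bullet> x - ?R y \<bullet> x"
    by (simp add: pos_blinfun_symmetric[OF S(1)] pos_blinfun_symmetric[OF R(1)] inner_diff_right
        flip: inner_diff_right y_def)
  then show "S x = ?R x" using \<open>S y = 0\<close> \<open>?R y = 0\<close> by (simp add: y_def)
qed

section \<open>The mixed Schwarz inequality\<close>

text \<open>With \<open>T = |A|\<close> and \<open>S = |A\<^sup>*|\<close> one has \<open>A T = S A\<close>. For \<open>x = T z\<close> the claim is thus the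
  Cauchy--Schwarz inequality of \<open>S\<close> at \<open>A z\<close> and \<open>y\<close>; on the kernel of \<open>T\<close>, the orthogonal
  complement of its range, \<open>A\<close> vanishes.\<close>

lemma mixed_schwarz_blinfun:
  fixes A A' T S :: "'a::{real_inner, banach} \<Rightarrow>\<^sub>L 'a"
  assumes adj: "\<And>x y. A x \<bullet> y = x \<bullet> A' y"
    and T: "pos_blinfun T" "T o\<^sub>L T = A' o\<^sub>L A"
    and S: "pos_blinfun S" "S o\<^sub>L S = A o\<^sub>L A'"
  shows "(A x \<bullet> y)\<^sup>2 \<le> (T x \<bullet> x) * (S y \<bullet> y)"
proof -
  have adj': "A' x \<bullet> y = x \<bullet> A y" for x y by (metis adj inner_commute)
  have pos: "pos_blinfun (A' o\<^sub>L A)" "pos_blinfun (A o\<^sub>L A')"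
    using adj adj' by (simp_all add: pos_blinfun_def) (metis inner_ge_zero)+
  \<comment> \<open>Intertwining needs one bound for both products; the summand 1 keeps it positive
    when A = 0.\<close>
  define k where "k = norm (A' o\<^sub>L A) + norm (A o\<^sub>L A') + 1"
  have k: "0 < k" "norm (A' o\<^sub>L A) \<le> k" "norm (A o\<^sub>L A') \<le> k"
    by (simp_all add: k_def add_nonneg_pos)
  have "A o\<^sub>L bounded_root k (A' o\<^sub>L A) = bounded_root k (A o\<^sub>L A') o\<^sub>L A"
    by (intro bounded_root_intertwine pos k) (simp add: blinfun_compose_assoc)
  moreover have "T = bounded_root k (A' o\<^sub>L A)" "S = bounded_root k (A o\<^sub>L A')"
    by (intro bounded_root_unique pos k T S)+
  ultimately have AT: "A (T z) = S (A z)" for z by (metis blinfun_apply_blinfun_compose)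
  have TT: "T (T z) = A' (A z)" for z using T(2) by (metis blinfun_apply_blinfun_compose)

  let ?good = "\<lambda>u. (A u \<bullet> y)\<^sup>2 \<le> (T u \<bullet> u) * (S y \<bullet> y)"
  have "?good (T z)" for z
  proof -
    have "(S (A z) \<bullet> y)\<^sup>2 \<le> (S (A z) \<bullet> A z) * (S y \<bullet> y)"
      by (rule pos_blinfun_cauchy_schwarz[OF S(1)])
    also have "S (A z) \<bullet> A z = T (T z) \<bullet> T z"
      by (metis AT TT adj inner_commute)
    finally show ?thesis by (simp add: AT)
  qed
  then have "range T \<subseteq> Collect ?good" by auto
  moreover have "closed (Collect ?good)"
    by (intro closed_Collect_le continuous_intros)
  ultimately have good: "closure (range T) \<subseteq> Collect ?good" by (rule closure_minimal)

  have "subspace (range T)"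
    by (intro linear_subspace_image subspace_UNIV bounded_linear.linear blinfun.bounded_linear_right)
  then have "subspace (closure (range T))" by (rule subspace_closure_of_subspace)
  \<comment> \<open>u is the orthogonal projection of x onto the closed range, obtained as the
    vector representing w -> x . w there.\<close>
  then obtain u where u: "u \<in> closure (range T)"
    and orth: "\<And>w. w \<in> closure (range T) \<Longrightarrow> u \<bullet> w = x \<bullet> w"
    using riesz_representation_on_closed_subspace[OF bounded_linear_inner_right[of x]]
      closed_closure by metis
  have "T (x - u) \<bullet> w = 0" for w
    using orth[of "T w"] subsetD[OF closure_subset, of "T w" "range T"]
    by (simp add: pos_blinfun_symmetric[OF T(1)] inner_diff_left)
  then have Tv: "T (x - u) = 0" by (metis inner_eq_zero_iff)
  \<comment> \<open>With v = x - u: |A v|^2 = v . A' (A v) = v . T (T v), and T v = 0.\<close>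
  have "A (x - u) \<bullet> A (x - u) = 0" by (simp only: adj TT[symmetric] Tv) simp
  then have "A x = A u" by (simp add: blinfun.diff_right)
  have Tx: "T x = T u" using Tv by (simp add: blinfun.diff_right)
  then have "T x \<bullet> x = T u \<bullet> u" by (metis pos_blinfun_symmetric[OF T(1)])
  moreover have "?good u" using good u by blast
  ultimately show ?thesis using \<open>A x = A u\<close> by simp
qed

section \<open>Complex Hilbert space\<close>

instance chilbert_space \<subseteq> banach ..

lemma cinner_scaleC_right: "cinner x (a *\<^sub>C y) = cnj a * cinner x y"
  by (subst (1 2) cinner_commute) (simp add: cinner_scaleC_left)

text \<open>Identities for the real inner product, taken at i x, yield those for imaginary parts;
  adjoints and symmetry are transferred this way.\<close>

lemma Im_cinner: "Im (cinner x y) = - ((\<i> *\<^sub>C x) \<bullet> y)"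
  by (simp add: inner_eq_Re_cinner cinner_scaleC_left)

lemma norm_scaleC: "norm (a *\<^sub>C x) = cmod a * norm (x::'a::complex_inner)"
proof -
  have "complex_of_real ((norm (a *\<^sub>C x))\<^sup>2) = (a * cnj a) * complex_of_real ((norm x)\<^sup>2)"
    by (simp only: cinner_self[symmetric] cinner_scaleC_left cinner_scaleC_right mult_ac)
  also have "\<dots> = complex_of_real ((cmod a * norm x)\<^sup>2)"
    by (simp add: complex_norm_square[symmetric] power_mult_distrib del: of_real_power)
  finally have "(norm (a *\<^sub>C x))\<^sup>2 = (cmod a * norm x)\<^sup>2" by (simp only: of_real_eq_iff)
  then show ?thesis by simp
qed

lemma unit_phase: obtains \<theta> where "cmod \<theta> = 1" "\<theta> * c = complex_of_real (cmod c)"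
proof (cases "c = 0")
  case True
  then show ?thesis by (intro that[of 1]) auto
next
  case False
  show ?thesis
  proof (rule that)
    show "cmod (cnj c / complex_of_real (cmod c)) = 1" using False by (simp add: norm_divide)
    have "cnj c * c = (complex_of_real (cmod c))\<^sup>2"
      by (metis complex_norm_square mult.commute of_real_power)
    then show "cnj c / complex_of_real (cmod c) * c = complex_of_real (cmod c)"
      using False by (simp add: field_simps power2_eq_square)
  qed
qed

lemma cmod_cinner_le: "cmod (cinner x y) \<le> norm x * norm y"
proof -
  obtain \<theta> where \<theta>: "cmod \<theta> = 1" "\<theta> * cinner x y = complex_of_real (cmod (cinner x y))"
    by (rule unit_phase)
  have "cmod (cinner x y) = (\<theta> *\<^sub>C x) \<bullet> y"
    by (simp add: inner_eq_Re_cinner cinner_scaleC_left \<theta>(2))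
  also have "\<dots> \<le> norm (\<theta> *\<^sub>C x) * norm y" by (rule norm_cauchy_schwarz)
  finally show ?thesis by (simp add: norm_scaleC \<theta>(1))
qed

section \<open>Complex-linear operators, adjoints and moduli\<close>

lemma bounded_clinear_bounded_linear: "bounded_clinear A \<Longrightarrow> bounded_linear A"
  by (simp add: bounded_clinear_def)

lemma bounded_clinear_scaleC: "bounded_clinear A \<Longrightarrow> A (c *\<^sub>C x) = c *\<^sub>C A x"
  by (simp add: bounded_clinear_def)

lemma Blinfun_apply_clinear: "bounded_clinear A \<Longrightarrow> blinfun_apply (Blinfun A) = A"
  by (simp add: bounded_clinear_def bounded_linear_Blinfun_apply)

lemma scaleC_left_commute: "a *\<^sub>C b *\<^sub>C x = b *\<^sub>C a *\<^sub>C (x::'a::complex_inner)"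
  by (simp add: scaleC_scaleC mult.commute)

lemma bounded_linear_scaleC: "bounded_linear ((*\<^sub>C) c :: 'a::complex_inner \<Rightarrow> 'a)"
  by (rule bounded_linear_intro[where K = "cmod c"])
    (simp_all add: scaleC_add_right scaleR_scaleC scaleC_left_commute norm_scaleC)

lemma bounded_clinear_add:
  "bounded_clinear A \<Longrightarrow> bounded_clinear B \<Longrightarrow> bounded_clinear (\<lambda>x. A x + B x)"
  by (simp add: bounded_clinear_def bounded_linear_add scaleC_add_right)

lemma bounded_clinear_scaleC_left:
  "bounded_clinear A \<Longrightarrow> bounded_clinear (\<lambda>x. c *\<^sub>C A x)"
  by (simp add: bounded_clinear_def scaleC_left_commute
      bounded_linear_compose[OF bounded_linear_scaleC])

lemma bounded_clinear_compose:
  "bounded_clinear A \<Longrightarrow> bounded_clinear B \<Longrightarrow> bounded_clinear (A \<circ> B)"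
  unfolding o_def by (simp add: bounded_clinear_def bounded_linear_compose)

lemma bounded_clinear_id: "bounded_clinear (\<lambda>x. x)"
  by (simp add: bounded_clinear_def)

lemma cadjoint_unique:
  assumes "bounded_clinear A'" "\<And>x y. cinner (A x) y = cinner x (A' y)"
  shows "cadjoint A = A'"
  unfolding cadjoint_def
proof (rule the_equality)
  fix B assume B: "bounded_clinear B \<and> (\<forall>x y. cinner (A x) y = cinner x (B y))"
  show "B = A'"
  proof
    fix y
    have "x \<bullet> B y = x \<bullet> A' y" for x using B assms(2) by (metis inner_eq_Re_cinner)
    then show "B y = A' y" using vector_eq_ldot by blast
  qed
qed (use assms in blast)

text \<open>The adjoint for the real inner product is already the complex one, because A commutes
  with multiplication by i.\<close>

lemma
  fixes A :: "'a::chilbert_space \<Rightarrow> 'a"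
  assumes A: "bounded_clinear A"
  shows bounded_clinear_cadjoint: "bounded_clinear (cadjoint A)"
    and cinner_cadjoint: "cinner (A x) y = cinner x (cadjoint A y)"
proof -
  obtain A' where A': "bounded_linear A'" "\<And>x y. A x \<bullet> y = x \<bullet> A' y"
    using hilbert_adjoint_exists[OF bounded_clinear_bounded_linear[OF A]] by blast
  have cinner: "cinner (A x) y = cinner x (A' y)" for x y
  proof (rule complex_eqI)
    show "Re (cinner (A x) y) = Re (cinner x (A' y))"
      using A'(2) by (simp add: inner_eq_Re_cinner)
    show "Im (cinner (A x) y) = Im (cinner x (A' y))"
      by (simp add: Im_cinner A'(2) flip: bounded_clinear_scaleC[OF A])
  qed
  have "A' (c *\<^sub>C y) = c *\<^sub>C A' y" for c y
  proof -
    have "x \<bullet> A' (c *\<^sub>C y) = x \<bullet> (c *\<^sub>C A' y)" for x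
      by (simp add: inner_eq_Re_cinner cinner_scaleC_right flip: cinner)
    then show ?thesis using vector_eq_ldot by blast
  qed
  then have clin: "bounded_clinear A'" using A'(1) by (simp add: bounded_clinear_def)
  have eq: "cadjoint A = A'" by (rule cadjoint_unique[OF clin cinner])
  show "bounded_clinear (cadjoint A)" by (simp add: eq clin)
  show "cinner (A x) y = cinner x (cadjoint A y)" by (simp add: eq cinner)
qed

lemma cadjoint_cadjoint:
  fixes A :: "'a::chilbert_space \<Rightarrow> 'a"
  assumes "bounded_clinear A"
  shows "cadjoint (cadjoint A) = A"
  by (rule cadjoint_unique[OF assms]) (metis assms cinner_cadjoint cinner_commute)

lemma positive_op_clinear: "positive_op T \<Longrightarrow> bounded_clinear T"
  by (simp add: positive_op_def)

text \<open>A complex positive operator is automatically symmetric, by polarisation.\<close>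

lemma positive_op_iff:
  "positive_op T \<longleftrightarrow> bounded_clinear T \<and> pos_blinfun (Blinfun T)"
proof (intro iffI conjI)
  assume T: "positive_op T"
  then show lin: "bounded_clinear T" by (rule positive_op_clinear)
  interpret bounded_linear T by (rule bounded_clinear_bounded_linear[OF lin])
  have real: "Im (cinner (T x) x) = 0" and nonneg: "0 \<le> T x \<bullet> x" for x
    using T by (auto simp: positive_op_def inner_eq_Re_cinner complex_nonneg_Reals_iff)
  have "T x \<bullet> y = x \<bullet> T y" for x y
  proof -
    \<comment> \<open>Expanding at i x + y, the diagonal terms vanish and the cross terms are - T x
      . y and T y . x.\<close>
    have "Im (cinner (T (\<i> *\<^sub>C x + y)) (\<i> *\<^sub>C x + y)) = 0" by (rule real)
    then have "(\<i> *\<^sub>C T (\<i> *\<^sub>C x) + \<i> *\<^sub>C T y) \<bullet> (\<i> *\<^sub>C x + y) = 0"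
      by (simp add: Im_cinner add scaleC_add_right)
    moreover have "(\<i> *\<^sub>C T (\<i> *\<^sub>C x)) \<bullet> (\<i> *\<^sub>C x) = 0" "(\<i> *\<^sub>C T y) \<bullet> y = 0"
      using real[of "\<i> *\<^sub>C x"] real[of y] by (simp_all add: Im_cinner)
    ultimately have "(\<i> *\<^sub>C T (\<i> *\<^sub>C x)) \<bullet> y + (\<i> *\<^sub>C T y) \<bullet> (\<i> *\<^sub>C x) = 0"
      by (simp add: inner_add)
    then show ?thesis
      using cinner_commute[of x "T y"]
      by (simp add: bounded_clinear_scaleC[OF lin] inner_eq_Re_cinner cinner_scaleC_left
          cinner_scaleC_right)
  qed
  then show "pos_blinfun (Blinfun T)"
    using nonneg unfolding pos_blinfun_def Blinfun_apply_clinear[OF lin] by blast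
next
  assume T: "bounded_clinear T \<and> pos_blinfun (Blinfun T)"
  then have lin: "bounded_clinear T" and sym: "\<And>x y. T x \<bullet> y = x \<bullet> T y"
    and nonneg: "\<And>x. 0 \<le> T x \<bullet> x"
    unfolding pos_blinfun_def by (auto simp: Blinfun_apply_clinear)
  have "Im (cinner (T x) x) = 0" for x
  proof -
    have "Im (cinner (T x) x) = - (T (\<i> *\<^sub>C x) \<bullet> x)"
      by (simp add: Im_cinner bounded_clinear_scaleC[OF lin])
    also have "\<dots> = Im (cinner x (T x))" by (simp add: sym Im_cinner)
    also have "\<dots> = - Im (cinner (T x) x)" by (subst cinner_commute) simp
    finally show ?thesis by simp
  qed
  then show "positive_op T"
    using lin nonneg by (auto simp: positive_op_def inner_eq_Re_cinner complex_nonneg_Reals_iff)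
qed

lemma positive_op_cinner:
  assumes "positive_op T"
  shows "cinner (T x) x = complex_of_real (T x \<bullet> x)" "0 \<le> T x \<bullet> x"
proof -
  have "cinner (T x) x \<in> \<real>\<^sub>\<ge>\<^sub>0" using assms by (simp add: positive_op_def)
  then show "cinner (T x) x = complex_of_real (T x \<bullet> x)" "0 \<le> T x \<bullet> x"
    by (auto simp: complex_nonneg_Reals_iff inner_eq_Re_cinner complex_eq_iff)
qed

text \<open>Gives meaning to the description in \<open>sqrt_op\<close>. Root and uniqueness come
  from the real theory; complex linearity has to be added.\<close>

lemma positive_sqrt_ex1:
  fixes T :: "'a::chilbert_space \<Rightarrow> 'a"
  assumes "positive_op T"
  shows "\<exists>!S. positive_op S \<and> S \<circ> S = T"
proof -
  let ?T = "Blinfun T"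
  have lin: "bounded_clinear T" and T: "pos_blinfun ?T" using assms positive_op_iff by auto
  note app = Blinfun_apply_clinear[OF lin]
  define k where "k = norm ?T + 1"
  have k: "0 < k" "norm ?T \<le> k" by (simp_all add: k_def add_nonneg_pos)
  define R where "R = bounded_root k ?T"
  have pos: "pos_blinfun R" and sq: "R o\<^sub>L R = ?T"
    unfolding R_def by (rule pos_bounded_root[OF T k], rule bounded_root_square[OF T k])
  have "R (c *\<^sub>C x) = c *\<^sub>C R x" for c x
  proof -
    \<comment> \<open>Multiplication by c is a bounded real-linear operator commuting with
      \<open>T\<close>, hence with its root.\<close>
    let ?C = "Blinfun ((*\<^sub>C) c) :: 'a \<Rightarrow>\<^sub>L 'a"
    have C: "blinfun_apply ?C = (*\<^sub>C) c" by (rule bounded_linear_Blinfun_apply[OF bounded_linear_scaleC])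
    have "?C o\<^sub>L ?T = ?T o\<^sub>L ?C"
      by (rule blinfun_eqI) (simp add: C app bounded_clinear_scaleC[OF lin])
    then have "?C o\<^sub>L R = R o\<^sub>L ?C" unfolding R_def by (intro bounded_root_intertwine T k)
    then have "(?C o\<^sub>L R) x = (R o\<^sub>L ?C) x" by simp
    then show ?thesis by (simp add: C)
  qed
  then have "bounded_clinear R" by (simp add: bounded_clinear_def blinfun.bounded_linear_right)
  then have "positive_op R" by (simp add: positive_op_iff pos blinfun_apply_inverse)
  moreover have "blinfun_apply R \<circ> blinfun_apply R = T"
    using arg_cong[OF sq, of blinfun_apply] by (simp add: app blinfun_compose.rep_eq)
  moreover have "S = R" if S: "positive_op S" "S \<circ> S = T" for S
  proof -
    have S': "bounded_clinear S" "pos_blinfun (Blinfun S)" using S(1) positive_op_iff by auto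
    have "Blinfun S o\<^sub>L Blinfun S = ?T"
      using fun_cong[OF S(2)]
      by (intro blinfun_eqI) (simp add: app Blinfun_apply_clinear[OF S'(1)])
    then have "Blinfun S = R" unfolding R_def by (intro bounded_root_unique T k S')
    then show ?thesis using Blinfun_apply_clinear[OF S'(1)] by simp
  qed
  ultimately show ?thesis by blast
qed

lemma sqrt_op:
  fixes T :: "'a::chilbert_space \<Rightarrow> 'a"
  assumes "positive_op T"
  shows "positive_op (sqrt_op T)" "sqrt_op T \<circ> sqrt_op T = T"
  using theI'[OF positive_sqrt_ex1[OF assms]] unfolding sqrt_op_def by auto

lemma sqrt_op_unique:
  fixes T :: "'a::chilbert_space \<Rightarrow> 'a"
  assumes "positive_op S" "S \<circ> S = T" "positive_op T"
  shows "sqrt_op T = S"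
  using positive_sqrt_ex1[OF assms(3)] sqrt_op[OF assms(3)] assms(1,2) by blast

lemma positive_op_cadjoint_compose:
  fixes A :: "'a::chilbert_space \<Rightarrow> 'a"
  assumes A: "bounded_clinear A"
  shows "positive_op (cadjoint A \<circ> A)"
proof -
  have "cinner (cadjoint A (A x)) x = complex_of_real ((norm (A x))\<^sup>2)" for x
    using cinner_cadjoint[OF bounded_clinear_cadjoint[OF A], of "A x" x]
    by (simp add: cadjoint_cadjoint[OF A] cinner_self)
  then show ?thesis
    by (simp add: positive_op_def bounded_clinear_compose bounded_clinear_cadjoint A
        del: of_real_power)
qed

lemma
  fixes A :: "'a::chilbert_space \<Rightarrow> 'a"
  assumes "bounded_clinear A"
  shows positive_op_abs_op: "positive_op (abs_op A)"
    and abs_op_square: "abs_op A \<circ> abs_op A = cadjoint A \<circ> A"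
  unfolding abs_op_def using sqrt_op[OF positive_op_cadjoint_compose[OF assms]] by auto

text \<open>The real version only bounds the real part. Replacing x by \<theta> x turns the left
  side into the modulus and fixes the right side, since \<theta> has modulus 1.\<close>

lemma mixed_schwarz:
  fixes A :: "'a::chilbert_space \<Rightarrow> 'a"
  assumes A: "bounded_clinear A"
  shows "(cmod (cinner (A x) y))\<^sup>2 \<le> (abs_op A x \<bullet> x) * (abs_op (cadjoint A) y \<bullet> y)"
proof -
  let ?A' = "cadjoint A"
  note A' = bounded_clinear_cadjoint[OF A]
  note T = positive_op_abs_op[OF A] and S = positive_op_abs_op[OF A']
  note app = Blinfun_apply_clinear[OF A] Blinfun_apply_clinear[OF A']
    Blinfun_apply_clinear[OF positive_op_clinear[OF T]]
    Blinfun_apply_clinear[OF positive_op_clinear[OF S]]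
  have real: "(A x \<bullet> y)\<^sup>2 \<le> (abs_op A x \<bullet> x) * (abs_op ?A' y \<bullet> y)" for x
  proof -
    have "(Blinfun A x \<bullet> y)\<^sup>2 \<le> (Blinfun (abs_op A) x \<bullet> x) * (Blinfun (abs_op ?A') y \<bullet> y)"
    proof (rule mixed_schwarz_blinfun)
      show "Blinfun A x \<bullet> y = x \<bullet> Blinfun ?A' y" for x y
        by (simp add: app inner_eq_Re_cinner cinner_cadjoint[OF A])
      show "pos_blinfun (Blinfun (abs_op A))" "pos_blinfun (Blinfun (abs_op ?A'))"
        using T S positive_op_iff by auto
      show "Blinfun (abs_op A) o\<^sub>L Blinfun (abs_op A) = Blinfun ?A' o\<^sub>L Blinfun A"
        using fun_cong[OF abs_op_square[OF A]] by (intro blinfun_eqI) (simp add: app)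
      show "Blinfun (abs_op ?A') o\<^sub>L Blinfun (abs_op ?A') = Blinfun A o\<^sub>L Blinfun ?A'"
        using fun_cong[OF abs_op_square[OF A']]
        by (intro blinfun_eqI) (simp add: app cadjoint_cadjoint[OF A])
    qed
    then show ?thesis by (simp add: app)
  qed
  obtain \<theta> where \<theta>: "cmod \<theta> = 1" "\<theta> * cinner (A x) y = complex_of_real (cmod (cinner (A x) y))"
    by (rule unit_phase)
  have "cmod (cinner (A x) y) = A (\<theta> *\<^sub>C x) \<bullet> y"
    by (simp add: inner_eq_Re_cinner bounded_clinear_scaleC[OF A] cinner_scaleC_left \<theta>(2))
  moreover have "abs_op A (\<theta> *\<^sub>C x) \<bullet> (\<theta> *\<^sub>C x) = abs_op A x \<bullet> x"
  proof -
    have "cinner (abs_op A (\<theta> *\<^sub>C x)) (\<theta> *\<^sub>C x) = (\<theta> * cnj \<theta>) * cinner (abs_op A x) x"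
      by (simp add: bounded_clinear_scaleC[OF positive_op_clinear[OF T]] cinner_scaleC_left
          cinner_scaleC_right)
    also have "\<theta> * cnj \<theta> = 1" by (simp add: complex_norm_square[symmetric] \<theta>(1))
    finally show ?thesis by (simp add: inner_eq_Re_cinner)
  qed
  ultimately show ?thesis using real[of "\<theta> *\<^sub>C x"] by simp
qed

section \<open>From mixed Schwarz to the numerical radius\<close>

lemma cmod_cinner_le_abs_op:
  fixes A :: "'a::chilbert_space \<Rightarrow> 'a"
  assumes A: "bounded_clinear A"
  shows "cmod (cinner (A x) x) \<le> (abs_op A x \<bullet> x + abs_op (cadjoint A) x \<bullet> x) / 2"
proof -
  define t where "t = abs_op A x \<bullet> x"
  define s where "s = abs_op (cadjoint A) x \<bullet> x"
  have nonneg: "0 \<le> t" "0 \<le> s"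
    unfolding t_def s_def
    by (rule positive_op_cinner(2)[OF positive_op_abs_op[OF A]],
        rule positive_op_cinner(2)[OF positive_op_abs_op[OF bounded_clinear_cadjoint[OF A]]])
  have "(cmod (cinner (A x) x))\<^sup>2 \<le> t * s"
    unfolding t_def s_def by (rule mixed_schwarz[OF A])
  also have "\<dots> \<le> ((t + s) / 2)\<^sup>2"
    using zero_le_power2[of "t - s"] by (simp add: field_simps power2_eq_square)
  finally have "cmod (cinner (A x) x) \<le> (t + s) / 2"
    by (rule power2_le_imp_le) (use nonneg in simp)
  then show ?thesis by (simp only: t_def s_def)
qed

text \<open>A real supremum bounds its members only when the set is bounded above; any operator
  bound \<open>K\<close> provides this.\<close>

lemma cmod_cinner_le_numerical_radius:
  fixes A :: "'a::complex_inner \<Rightarrow> 'a"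
  assumes A: "bounded_clinear A" and x: "norm x = 1"
  shows "cmod (cinner (A x) x) \<le> numerical_radius A"
  unfolding numerical_radius_def
proof (rule cSUP_upper)
  obtain K where K: "\<And>x. norm (A x) \<le> norm x * K"
    using bounded_linear.bounded[OF bounded_clinear_bounded_linear[OF A]] by blast
  have "cmod (cinner (A y) y) \<le> K" if "norm y = 1" for y
    using cmod_cinner_le[of "A y" y] K[of y] that by simp
  then show "bdd_above ((\<lambda>x. cmod (cinner (A x) x)) ` {x. norm x = 1})"
    by (auto intro!: bdd_aboveI)
qed (use x in simp)

lemma cadjoint_id: "cadjoint (\<lambda>x::'a::complex_inner. x) = (\<lambda>x. x)"
  by (simp add: cadjoint_unique bounded_clinear_id)

lemma abs_op_id: "abs_op (\<lambda>x::'a::chilbert_space. x) = (\<lambda>x. x)"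
proof -
  have "positive_op (\<lambda>x::'a. x)"
    by (simp add: positive_op_def bounded_clinear_id cinner_self del: of_real_power)
  then show ?thesis by (simp add: abs_op_def cadjoint_id o_def sqrt_op_unique)
qed

text \<open>The constant is shown to be optimal on every nonzero space separately, since the
  identity operator is always available as an extremal case.\<close>

theorem theorem2p2:
  assumes "\<exists>x::'a::chilbert_space. x \<noteq> 0"
  shows "(\<forall>A B :: 'a \<Rightarrow> 'a. bounded_clinear A \<longrightarrow> bounded_clinear B \<longrightarrow>
           numerical_radius (\<lambda>x. A x + B x)
             \<le> 1 / sqrt 2 * numerical_radius
                 (\<lambda>x. (abs_op A x + abs_op (cadjoint A) x)
                    + \<i> *\<^sub>C (abs_op B x + abs_op (cadjoint B) x)))
       \<and> \<not> (\<exists>c::real. c < 1 / sqrt 2 \<and>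
           (\<forall>A B :: 'a \<Rightarrow> 'a. bounded_clinear A \<longrightarrow> bounded_clinear B \<longrightarrow>
             numerical_radius (\<lambda>x. A x + B x)
               \<le> c * numerical_radius
                   (\<lambda>x. (abs_op A x + abs_op (cadjoint A) x)
                      + \<i> *\<^sub>C (abs_op B x + abs_op (cadjoint B) x))))"
proof (intro conjI allI impI notI)
  obtain z :: 'a where "z \<noteq> 0" using assms by blast
  \<comment> \<open>Nonemptiness of the sphere is needed both to bound the supremum from above and
    to evaluate it for a constant family.\<close>
  then have "norm ((1 / norm z) *\<^sub>R z) = 1" by simp
  then have sphere: "{x::'a. norm x = 1} \<noteq> {}" by blast
  {
    fix A B :: "'a \<Rightarrow> 'a"
    assume A: "bounded_clinear A" and B: "bounded_clinear B"
    note A' = bounded_clinear_cadjoint[OF A] and B' = bounded_clinear_cadjoint[OF B]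
    note pos = positive_op_abs_op[OF A] positive_op_abs_op[OF A']
      positive_op_abs_op[OF B] positive_op_abs_op[OF B']
    let ?D = "\<lambda>x. (abs_op A x + abs_op (cadjoint A) x)
      + \<i> *\<^sub>C (abs_op B x + abs_op (cadjoint B) x)"
    have D: "bounded_clinear ?D"
      by (intro bounded_clinear_add bounded_clinear_scaleC_left positive_op_clinear pos)
    show "numerical_radius (\<lambda>x. A x + B x) \<le> 1 / sqrt 2 * numerical_radius ?D"
      unfolding numerical_radius_def[of "\<lambda>x. A x + B x"]
    proof (rule cSUP_least[OF sphere], clarify)
      fix x :: 'a assume x: "norm x = 1"
      define p where "p = abs_op A x \<bullet> x + abs_op (cadjoint A) x \<bullet> x"
      define q where "q = abs_op B x \<bullet> x + abs_op (cadjoint B) x \<bullet> x"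
      \<comment> \<open>The forms of the four positive operators are real, so p and q are exactly
        the real and imaginary parts.\<close>
      have "cinner (?D x) x = Complex p q"
        by (simp add: cinner_add_left cinner_scaleC_left positive_op_cinner(1)[OF pos(1)]
            positive_op_cinner(1)[OF pos(2)] positive_op_cinner(1)[OF pos(3)]
            positive_op_cinner(1)[OF pos(4)] p_def q_def complex_eq_iff)
      then have pq: "sqrt (p\<^sup>2 + q\<^sup>2) = cmod (cinner (?D x) x)" by (simp add: complex_norm)
      have "(p / 2 + q / 2)\<^sup>2 \<le> (p\<^sup>2 + q\<^sup>2) / 2"
        using zero_le_power2[of "p - q"] by (simp add: field_simps power2_eq_square)
      then have "p / 2 + q / 2 \<le> sqrt ((p\<^sup>2 + q\<^sup>2) / 2)" by (rule real_le_rsqrt)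
      then have "p / 2 + q / 2 \<le> 1 / sqrt 2 * cmod (cinner (?D x) x)"
        by (simp only: real_sqrt_divide pq mult_1 times_divide_eq_left)
      moreover have "cmod (cinner (A x + B x) x) \<le> cmod (cinner (A x) x) + cmod (cinner (B x) x)"
        by (simp add: cinner_add_left norm_triangle_ineq)
      moreover have "\<dots> \<le> p / 2 + q / 2"
        unfolding p_def q_def by (intro add_mono cmod_cinner_le_abs_op A B)
      moreover have "1 / sqrt 2 * cmod (cinner (?D x) x) \<le> 1 / sqrt 2 * numerical_radius ?D"
        by (intro mult_left_mono cmod_cinner_le_numerical_radius[OF D x]) simp
      ultimately show "cmod (cinner (A x + B x) x) \<le> 1 / sqrt 2 * numerical_radius ?D"
        by linarith
    qed
  }
  text \<open>Equality holds for \<open>A = B = 1\<close>, where the two numerical radii are \<open>2\<close> and \<open>|2 + 2\<i>|\<close>.\<close>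
  assume "\<exists>c<1 / sqrt 2. \<forall>A B :: 'a \<Rightarrow> 'a. bounded_clinear A \<longrightarrow> bounded_clinear B \<longrightarrow>
      numerical_radius (\<lambda>x. A x + B x)
        \<le> c * numerical_radius
            (\<lambda>x. (abs_op A x + abs_op (cadjoint A) x)
               + \<i> *\<^sub>C (abs_op B x + abs_op (cadjoint B) x))"
  then obtain c where c: "c < 1 / sqrt 2"
    and le: "numerical_radius (\<lambda>x::'a. x + x)
      \<le> c * numerical_radius (\<lambda>x::'a. (x + x) + \<i> *\<^sub>C (x + x))"
    using bounded_clinear_id by (auto simp: cadjoint_id abs_op_id dest!: spec[of _ "\<lambda>x. x"])
  have radius: "numerical_radius A = r"
    if "\<And>x. norm x = 1 \<Longrightarrow> cmod (cinner (A x) x) = r" for A :: "'a \<Rightarrow> 'a" and r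
  proof -
    have "(\<lambda>x. cmod (cinner (A x) x)) ` {x. norm x = 1} = {r}" using that sphere by auto
    then show ?thesis by (simp add: numerical_radius_def)
  qed
  have "numerical_radius (\<lambda>x::'a. x + x) = 2"
    by (rule radius) (simp add: cinner_add_left cinner_self)
  moreover have "numerical_radius (\<lambda>x::'a. (x + x) + \<i> *\<^sub>C (x + x)) = 2 * sqrt 2"
  proof (rule radius)
    fix x :: 'a assume "norm x = 1"
    then have "cinner ((x + x) + \<i> *\<^sub>C (x + x)) x = Complex 2 2"
      by (simp add: cinner_add_left cinner_scaleC_left cinner_self complex_eq_iff)
    then show "cmod (cinner ((x + x) + \<i> *\<^sub>C (x + x)) x) = 2 * sqrt 2"
      using real_sqrt_mult[of 4 2] by (simp add: complex_norm)
  qed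
  ultimately have "2 \<le> c * (2 * sqrt 2)" using le by simp
  moreover have "c * (2 * sqrt 2) < 2" using c by (simp add: field_simps)
  ultimately show False by simp
qed

end
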